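(* Let $N\ge 1$, $n=\sum_{i=1}^N n_i$, let $f:\mathbb{R}^n\to\mathbb{R}$ be differentiable and let $X\subseteq\mathbb{R}^n$. Assume: (1) $X=X_1\times\cdots\times X_N$ with each $X_i\subseteq\mathbb{R}^{n_i}$ nonempty, closed and convex. (2) $f$ is bounded from below on $X$. (3) There are constants $L^i_j\ge 0$ ($i,j\in[N]$), with $L^i_j=L^j_i$, such that for all $i,j\in[N]$ and all $x,y\in X$ with $x^{[k]}=y^{[k]}$ for every $k\ne j$, one has $\|\nabla^{[i]}f(x)-\nabla^{[i]}f(y)\|\le L^i_j\|x^{[j]}-y^{[j]}\|$. (4) For every $i,j\in[N]$ there is an integer $D^j_i\ge 0$ such that $0\le t-\tau^j_i(t)\le D^j_i$ for all $t\in T^i$ (with $D^i_i=0$, and $D^j_i=D^i_j=0$ whenever $L^i_j=0$). (5) For every $i\in[N]$ there is an integer $G_i\ge 0$ such that $T^i\cap\{t,t+1,\dots,t+G_i\}\neq\emptyset$ for every $t\in\{0,1,2,\dots\}$. (6) (Error bound.) For every $\alpha>0$ there exist $\delta,\kappa>0$ such that for all $x\in X$ with $f(x)\le\alpha$ and $\|x-\Pi_X[x-\nabla f(x)]\|\le\delta$, $$\min_{\bar x\in X^*}\|x-\bar x\|\le\kappa\,\|x-\Pi_X[x-\nabla f(x)]\|$$ (in particular the minimum exists, so $X^*\neq\emptyset$ whenever such an $x$ exists). (7) There exists $\epsilon>0$ such that $\|x-y\|\ge\epsilon$ for every pair of distinct $x,y\in X^*$. Let the local iterates $x_1(t),\dots,x_N(t)$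 and the global state $x(t)$ be generated by Algorithm 1 (described in the context) with stepsizes satisfying, for all $i\in[N]$, $$\gamma_i\in\left(0,\ \frac{2}{\sum_{j=1}^N L^i_j\,(1+D^j_i+D^i_j)}\right).$$ Then there exists $x^*\in X^*$ such that $$\lim_{t\to\infty}\|x(t)-x^*\|=0.$$
   Context: Notation. $[N]=\{1,\dots,N\}$; $\|\cdot\|$ is the Euclidean norm. A vector $v\in\mathbb{R}^n$ with $n=\sum_{i=1}^N n_i$ is split into $N$ consecutive blocks $v^{[i]}\in\mathbb{R}^{n_i}$; $\nabla^{[i]}f(x)\in\mathbb{R}^{n_i}$ is the $i$-th block of $\nabla f(x)$. For a nonempty closed convex set $\Omega$, $\Pi_\Omega[y]$ is the Euclidean projection of $y$ onto $\Omega$. The solution set is $X^*=\{x\in X: x=\Pi_X[x-\nabla f(x)]\}$. A stepsize upper bound whose denominator is $0$ is read as $+\infty$. Algorithm 1 (partially asynchronous block coordinate descent). Time is $t=0,1,2,\dots$. Each agent $i\in[N]$ stores a local copy $x_i(t)\in\mathbb{R}^n$ of the decision variable, with blocks $x_i^{[j]}(t)$, starting from given $x_i(0)$; stepsizes $\gamma_1,\dots,\gamma_N>0$ are given. $T^i\subseteq\{0,1,2,\dots\}$ is the set of times at which agent $i$ computes an update of its own block: $$x_i^{[i]}(t+1)=\begin{cases}\Pi_{X_i}\big[x_i^{[i]}(t)-\gamma_i\nabla^{[i]}f(x_i(t))\big], & t\in T^i,\\ x_i^{[i]}(t), & t\notin T^i.\end{cases}$$ For $j\ne i$, agent $i$'s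 copy $x_i^{[j]}$ of agent $j$'s block changes only when agent $i$ receives a (possibly delayed) value of $x_j^{[j]}$ from agent $j$: $x_i^{[j]}(t+1)=x_j^{[j]}(\tau^j_i(t+1))$ if agent $i$ receives $x_j^{[j]}$ at time $t+1$, and $x_i^{[j]}(t+1)=x_i^{[j]}(t)$ otherwise. Here $\tau^j_i(t)$ is the largest time index with $0\le\tau^j_i(t)\le t$ and $x_i^{[j]}(t)=x_j^{[j]}(\tau^j_i(t))$; such an index always exists, so $x_i(t)=(x_1^{[1]}(\tau^1_i(t)),\dots,x_N^{[N]}(\tau^N_i(t)))$ for all $t\geq 0$, and $\tau^i_i(t)=t$. The sets $T^i$ and the delays $\tau^j_i$ are otherwise arbitrary. The global state is $x(t)=(x_1^{[1]}(t),\dots,x_N^{[N]}(t))$, i.e. $x^{[i]}(t)=x_i^{[i]}(t)$ for all $i$. *)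

theory Defs
  imports "HOL-Analysis.Analysis"
begin

text \<open>
  The splitting of \<open>\<real>\<^sup>n\<close> into blocks is given by a map \<open>blk\<close> from coordinates to agents: block \<open>i\<close>
  consists of the coordinates \<open>k\<close> with \<open>blk k = i\<close>. Since the dimension of a block depends on
  \<open>i\<close>, the space of block \<open>i\<close> is represented by its isometric copy inside \<open>real ^ 'n\<close>, the
  vectors vanishing outside block \<open>i\<close> (\<open>block_space\<close>). Consecutive blocks are a special case.
\<close>

definition block :: "('n::finite \<Rightarrow> 'a) \<Rightarrow> 'a \<Rightarrow> real ^ 'n \<Rightarrow> real ^ 'n" where
  "block blk i v = (\<chi> k. if blk k = i then v $ k else 0)"

definition block_space :: "('n::finite \<Rightarrow> 'a) \<Rightarrow> 'a \<Rightarrow> (real ^ 'n) set" where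
  "block_space blk i = {v. \<forall>k. blk k \<noteq> i \<longrightarrow> v $ k = 0}"

definition block_product :: "('n::finite \<Rightarrow> 'a) \<Rightarrow> ('a \<Rightarrow> (real ^ 'n) set) \<Rightarrow> (real ^ 'n) set" where
  "block_product blk Xs = {x. \<forall>i. block blk i x \<in> Xs i}"

definition grad :: "('v::real_inner \<Rightarrow> real) \<Rightarrow> 'v \<Rightarrow> 'v" where
  "grad f x = (THE D. GDERIV f x :> D)"

lemma grad_eq: "GDERIV f x :> D \<Longrightarrow> grad f x = D"
  unfolding grad_def gderiv_def
proof (rule the_equality)
  fix D' assume "(f has_derivative (\<lambda>h. inner h D)) (at x)" "(f has_derivative (\<lambda>h. inner h D')) (at x)"
  then have "(\<lambda>h. inner h D') = (\<lambda>h. inner h D)"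
    by (blast intro: has_derivative_unique)
  then show "D' = D"
    by (metis vector_eq_ldot)
qed

definition residual_vec :: "(real ^ 'n::finite) set \<Rightarrow> (real ^ 'n \<Rightarrow> real) \<Rightarrow> real ^ 'n \<Rightarrow> real ^ 'n" where
  "residual_vec X f x = x - closest_point X (x - grad f x)"

definition solution_set :: "(real ^ 'n::finite) set \<Rightarrow> (real ^ 'n \<Rightarrow> real) \<Rightarrow> (real ^ 'n) set" where
  "solution_set X f = {x \<in> X. x = closest_point X (x - grad f x)}"

text \<open>
  Below, \<open>x i t\<close> is the local copy of agent \<open>i\<close> at time \<open>t\<close>, \<open>T i\<close> is its set of update times,
  \<open>R i j\<close> is the set of times at which agent \<open>i\<close> receives a value from agent \<open>j\<close>, and \<open>\<tau> i j t\<close>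
  has the receiving agent \<open>i\<close> as its first index and the sending agent \<open>j\<close> as its second.
\<close>

definition latest_index ::
  "('n::finite \<Rightarrow> 'a) \<Rightarrow> ('a \<Rightarrow> nat \<Rightarrow> real ^ 'n) \<Rightarrow> 'a \<Rightarrow> 'a \<Rightarrow> nat \<Rightarrow> nat \<Rightarrow> bool" where
  "latest_index blk x i j t s \<longleftrightarrow>
     s \<le> t \<and> block blk j (x i t) = block blk j (x j s) \<and>
     (\<forall>s'\<le>t. block blk j (x i t) = block blk j (x j s') \<longrightarrow> s' \<le> s)"

definition async_bcd ::
  "('n::finite \<Rightarrow> 'a) \<Rightarrow> ('a \<Rightarrow> (real ^ 'n) set) \<Rightarrow> (real ^ 'n \<Rightarrow> real) \<Rightarrow> ('a \<Rightarrow> real) \<Rightarrow>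
   ('a \<Rightarrow> nat set) \<Rightarrow> ('a \<Rightarrow> 'a \<Rightarrow> nat set) \<Rightarrow> ('a \<Rightarrow> 'a \<Rightarrow> nat \<Rightarrow> nat) \<Rightarrow>
   ('a \<Rightarrow> nat \<Rightarrow> real ^ 'n) \<Rightarrow> bool" where
  "async_bcd blk Xs f \<gamma> T R \<tau> x \<longleftrightarrow>
     (\<forall>i t. block blk i (x i (t + 1)) =
        (if t \<in> T i
         then closest_point (Xs i) (block blk i (x i t) - \<gamma> i *\<^sub>R block blk i (grad f (x i t)))
         else block blk i (x i t))) \<and>
     (\<forall>i j t. j \<noteq> i \<longrightarrow> block blk j (x i (t + 1)) =
        (if t + 1 \<in> R i j
         then block blk j (x j (\<tau> i j (t + 1)))
         else block blk j (x i t))) \<and>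
     (\<forall>i j t. latest_index blk x i j t (\<tau> i j t))"

definition global_state ::
  "('n::finite \<Rightarrow> 'a) \<Rightarrow> ('a \<Rightarrow> nat \<Rightarrow> real ^ 'n) \<Rightarrow> nat \<Rightarrow> real ^ 'n" where
  "global_state blk x t = (\<chi> k. x (blk k) t $ k)"

end

theory Submission
  imports Defs
begin

text \<open>
  From some time on, every block lies in its constraint set. Then the block-wise descent inequality
  and the optimality condition of the projection bound the change of \<open>f\<close> along one step by the
  squared step lengths and by products of the present step with the recent ones, which come from the
  delays. By Young's inequality and the symmetry of \<open>L\<close>, the stepsize bound makes the total
  coefficient of every squared step negative, so the squared steps are summable: the steps tend to
  zero and \<open>f\<close> stays bounded above along the trajectory. All agents update within a bounded window,
  hence the residual at \<open>x(t)\<close> is bounded by the steps in this window. The error bound then drives the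
  distance to the solution set to zero, and since solutions are separated while steps vanish, the
  nearby solution is eventually the same.
\<close>

section \<open>Blocks of vectors and product sets\<close>

lemma block_nth [simp]: "block blk i v $ k = (if blk k = i then v $ k else 0)"
  by (simp add: block_def)

lemma block_diff: "block blk i (u - v) = block blk i u - block blk i v"
  by (simp add: vec_eq_iff)

lemma block_add: "block blk i (u + v) = block blk i u + block blk i v"
  by (simp add: vec_eq_iff)

lemma block_scaleR: "block blk i (c *\<^sub>R v) = c *\<^sub>R block blk i v"
  by (simp add: vec_eq_iff)

lemma sum_block: "(\<Sum>i\<in>UNIV. block blk i v) = v" for blk :: "'n::finite \<Rightarrow> 'a::finite"
  by (simp add: vec_eq_iff)

lemma inner_eq_sum_block:
  fixes blk :: "'n::finite \<Rightarrow> 'a::finite"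
  shows "u \<bullet> v = (\<Sum>i\<in>UNIV. block blk i u \<bullet> block blk i v)"
proof -
  have "(\<Sum>i\<in>UNIV. block blk i u \<bullet> block blk i v)
      = (\<Sum>k\<in>UNIV. \<Sum>i\<in>UNIV. if blk k = i then u $ k * v $ k else 0)"
    unfolding inner_vec_def by (subst sum.swap) (auto intro!: sum.cong)
  then show ?thesis
    by (simp add: inner_vec_def)
qed

lemma norm_block_le: "norm (block blk i v) \<le> norm v"
  by (rule norm_le_componentwise_cart) auto

lemma norm_le_sum_block:
  fixes blk :: "'n::finite \<Rightarrow> 'a::finite"
  shows "norm v \<le> (\<Sum>i\<in>UNIV. norm (block blk i v))"
  by (metis norm_sum sum_block)

text \<open>Gluing blocks of different vectors is needed twice: for the intermediate points between
  \<open>y\<close> and \<open>z\<close> when blocks are exchanged, and for combining block updates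
  made at different times.\<close>

definition assemble :: "('n::finite \<Rightarrow> 'a) \<Rightarrow> ('a \<Rightarrow> real ^ 'n) \<Rightarrow> real ^ 'n" where
  "assemble blk w = (\<chi> k. w (blk k) $ k)"

lemma block_assemble [simp]: "block blk i (assemble blk w) = block blk i (w i)"
  by (simp add: vec_eq_iff assemble_def)

lemma block_global_state [simp]: "block blk i (global_state blk x t) = block blk i (x i t)"
  by (simp add: vec_eq_iff global_state_def)

lemma block_eqI: "(\<And>i. block blk i u = block blk i v) \<Longrightarrow> u = v"
  by (metis block_nth vec_eq_iff)

lemma mem_block_product: "v \<in> block_product blk Xs \<longleftrightarrow> (\<forall>i. block blk i v \<in> Xs i)"
  by (simp add: block_product_def)

lemma convex_block_product:
  assumes "\<And>i. convex (Xs i)"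
  shows "convex (block_product blk Xs)"
  using assms by (auto simp: convex_def mem_block_product block_add block_scaleR)

lemma closed_block_product:
  assumes "\<And>i. closed (Xs i)"
  shows "closed (block_product blk Xs)"
proof -
  have "bounded_linear (block blk i)" for i
    by (simp add: linear_conv_bounded_linear[symmetric] linear_iff block_add block_scaleR)
  then have "closed {v. block blk i v \<in> Xs i}" for i
    using continuous_closed_vimage[OF assms, of "block blk i"]
    by (simp add: vimage_def linear_continuous_at)
  moreover have "block_product blk Xs = (\<Inter>i. {v. block blk i v \<in> Xs i})"
    by (auto simp: block_product_def)
  ultimately show ?thesis
    by auto
qed

text \<open>The blocks are exchanged one at a time.\<close>

lemma lipschitz_of_block_lipschitz:
  fixes blk :: "'n::finite \<Rightarrow> 'a::finite" and F :: "real ^ 'n \<Rightarrow> 'b::real_normed_vector"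
  assumes y: "y \<in> block_product blk Xs" and z: "z \<in> block_product blk Xs"
    and lip: "\<And>j y z. y \<in> block_product blk Xs \<Longrightarrow> z \<in> block_product blk Xs \<Longrightarrow>
          (\<And>k. k \<noteq> j \<Longrightarrow> block blk k y = block blk k z) \<Longrightarrow>
          norm (F y - F z) \<le> L j * norm (block blk j y - block blk j z)"
  shows "norm (F y - F z) \<le> (\<Sum>j\<in>UNIV. L j * norm (block blk j (y - z)))"
proof -
  define w where "w S = assemble blk (\<lambda>j. if j \<in> S then y else z)" for S
  have w: "w S \<in> block_product blk Xs" for S
    using y z by (simp add: mem_block_product w_def)
  have "norm (F (w S) - F z) \<le> (\<Sum>j\<in>S. L j * norm (block blk j (y - z)))" for S :: "'a set"
  proof (induction S rule: finite_induct[OF finite])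
    case 1
    have "w {} = z"
      by (rule block_eqI[of blk]) (simp add: w_def)
    then show ?case
      by simp
  next
    case (2 j S)
    have "norm (F (w (insert j S)) - F (w S)) \<le> L j * norm (block blk j (y - z))"
      using lip[OF w w, of j "insert j S" S] \<open>j \<notin> S\<close> by (simp add: w_def block_diff)
    with 2 show ?case
      by simp (smt (verit) norm_triangle_ineq diff_add_cancel add_diff_eq)
  qed
  moreover have "w UNIV = y"
    by (rule block_eqI[of blk]) (simp add: w_def)
  ultimately show ?thesis
    by metis
qed

section \<open>Gradients and the block-wise descent inequality\<close>

text \<open>\<open>grad\<close> is a definite description, so a vector representing the derivative
  has to be exhibited: its coordinates in the orthonormal basis are the values of the derivative on
  the basis vectors.\<close>

lemma GDERIV_grad:
  fixes f :: "'v::euclidean_space \<Rightarrow> real"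
  assumes "f differentiable (at y)"
  shows "GDERIV f y :> grad f y"
proof -
  obtain f' where f': "(f has_derivative f') (at y)"
    using assms by (auto simp: differentiable_def)
  interpret bounded_linear f'
    using f' by (rule has_derivative_bounded_linear)
  define v where "v = (\<Sum>b\<in>Basis. f' b *\<^sub>R b)"
  have "f' h = h \<bullet> v" for h
  proof -
    have "f' h = f' (\<Sum>b\<in>Basis. (h \<bullet> b) *\<^sub>R b)"
      by (simp add: euclidean_representation)
    then show ?thesis
      by (simp add: v_def sum scaleR inner_sum_right mult.commute)
  qed
  then have "f' = (\<lambda>h. h \<bullet> v)"
    by (rule ext)
  with f' have "GDERIV f y :> v"
    by (simp add: gderiv_def)
  then show ?thesis
    by (simp add: grad_eq)
qed

text \<open>Along the segment from \<open>y\<close> to \<open>z\<close> the Lipschitz bound lets the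
  directional derivative grow by at most \<theta> times the quadratic form in the block lengths.
  Subtracting the linear part and \<theta> squared times half this form leaves a nonincreasing
  function \<phi>; comparing its values at 0 and 1 replaces integration of the gradient.\<close>

lemma block_descent:
  fixes blk :: "'n::finite \<Rightarrow> 'a::finite" and f :: "real ^ 'n \<Rightarrow> real"
  assumes diff: "\<And>y. f differentiable (at y)" and "convex X" "y \<in> X" "z \<in> X"
    and lip: "\<And>i y z. y \<in> X \<Longrightarrow> z \<in> X \<Longrightarrow>
          norm (block blk i (grad f y - grad f z)) \<le> (\<Sum>j\<in>UNIV. L i j * norm (block blk j (y - z)))"
  shows "f z \<le> f y + grad f y \<bullet> (z - y)
      + (\<Sum>i\<in>UNIV. \<Sum>j\<in>UNIV. L i j * norm (block blk i (z - y)) * norm (block blk j (z - y))) / 2"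
    (is "_ \<le> _ + _ + ?K / 2")
proof -
  let ?s = "z - y"
  define \<phi> where "\<phi> \<theta> = f (y + \<theta> *\<^sub>R ?s) - \<theta> * (grad f y \<bullet> ?s) - \<theta>\<^sup>2 * ?K / 2" for \<theta>
  have "\<phi> 1 \<le> \<phi> 0"
  proof (rule DERIV_nonpos_imp_nonincreasing[where f = \<phi>])
    fix \<theta> :: real assume \<theta>: "0 \<le> \<theta>" "\<theta> \<le> 1"
    let ?p = "y + \<theta> *\<^sub>R ?s"
    have "?p = (1 - \<theta>) *\<^sub>R y + \<theta> *\<^sub>R z"
      by (simp add: algebra_simps)
    then have p: "?p \<in> X"
      using convexD_alt[OF \<open>convex X\<close> \<open>y \<in> X\<close> \<open>z \<in> X\<close> \<theta>] by simp
    have "((\<lambda>\<theta>. y + \<theta> *\<^sub>R ?s) has_derivative (\<lambda>h. h *\<^sub>R ?s)) (at \<theta>)"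
      by (auto intro!: derivative_eq_intros)
    moreover have "(f has_derivative (\<lambda>h. h \<bullet> grad f ?p)) (at ?p)"
      using GDERIV_grad[OF diff] by (simp add: gderiv_def)
    ultimately have "((\<lambda>\<theta>. f (y + \<theta> *\<^sub>R ?s)) has_derivative (\<lambda>h. (h *\<^sub>R ?s) \<bullet> grad f ?p)) (at \<theta>)"
      by (rule has_derivative_compose)
    then have "((\<lambda>\<theta>. f (y + \<theta> *\<^sub>R ?s)) has_real_derivative grad f ?p \<bullet> ?s) (at \<theta>)"
      by (simp add: has_field_derivative_def inner_commute mult.commute[of "grad f ?p \<bullet> ?s"] mult_commute_abs)
    then have "(\<phi> has_real_derivative grad f ?p \<bullet> ?s - grad f y \<bullet> ?s - \<theta> * ?K) (at \<theta>)"
      unfolding \<phi>_def by (auto intro!: derivative_eq_intros)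
    moreover have "grad f ?p \<bullet> ?s - grad f y \<bullet> ?s \<le> \<theta> * ?K"
    proof -
      have "grad f ?p \<bullet> ?s - grad f y \<bullet> ?s
          = (\<Sum>i\<in>UNIV. block blk i (grad f ?p - grad f y) \<bullet> block blk i ?s)"
        unfolding inner_diff_left[symmetric] by (rule inner_eq_sum_block)
      also have "\<dots> \<le> (\<Sum>i\<in>UNIV. (\<Sum>j\<in>UNIV. L i j * norm (block blk j (\<theta> *\<^sub>R ?s))) * norm (block blk i ?s))"
      proof (rule sum_mono)
        fix i
        have "norm (block blk i (grad f ?p - grad f y)) \<le> (\<Sum>j\<in>UNIV. L i j * norm (block blk j (\<theta> *\<^sub>R ?s)))"
          using lip[OF p \<open>y \<in> X\<close>, of i] by simp
        then show "block blk i (grad f ?p - grad f y) \<bullet> block blk i ?s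
            \<le> (\<Sum>j\<in>UNIV. L i j * norm (block blk j (\<theta> *\<^sub>R ?s))) * norm (block blk i ?s)"
          by (meson norm_cauchy_schwarz norm_ge_zero mult_right_mono order_trans)
      qed
      also have "\<dots> = \<theta> * ?K"
        using \<theta> by (simp add: block_scaleR sum_distrib_left sum_distrib_right mult_ac)
      finally show ?thesis .
    qed
    ultimately show "\<exists>d. (\<phi> has_real_derivative d) (at \<theta>) \<and> d \<le> 0"
      by (intro exI conjI) auto
  qed simp
  then show ?thesis
    by (simp add: \<phi>_def)
qed

section \<open>Summation of descent inequalities with delays\<close>

text \<open>After exchanging the sums, an index \<open>r\<close> is counted only for
  \<open>t\<close> in \<open>{r<..r + d}\<close>, that is, at most \<open>d\<close> times.
  Truncation in \<open>t - d\<close> does not change this.\<close>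

lemma delayed_sum_le:
  fixes b :: "nat \<Rightarrow> real"
  assumes "\<And>r. 0 \<le> b r"
  shows "(\<Sum>t<M. \<Sum>r\<in>{t - d..<t}. b r) \<le> real d * (\<Sum>r<M. b r)"
proof -
  have "(\<Sum>t<M. \<Sum>r\<in>{t - d..<t}. b r) = (\<Sum>t<M. \<Sum>r<M. if r \<in> {t - d..<t} then b r else 0)"
    by (intro sum.cong refl sum.mono_neutral_cong_left) auto
  also have "\<dots> = (\<Sum>r<M. \<Sum>t<M. if r \<in> {t - d..<t} then b r else 0)"
    by (rule sum.swap)
  also have "\<dots> \<le> (\<Sum>r<M. \<Sum>t\<in>{r<..r + d}. b r)"
  proof (rule sum_mono)
    fix r
    have "(\<Sum>t<M. if r \<in> {t - d..<t} then b r else 0) = (\<Sum>t\<in>{t\<in>{..<M}. r \<in> {t - d..<t}}. b r)"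
      by (rule sum.inter_filter[symmetric]) simp
    also have "\<dots> \<le> (\<Sum>t\<in>{r<..r + d}. b r)"
      using assms by (intro sum_mono2) auto
    finally show "(\<Sum>t<M. if r \<in> {t - d..<t} then b r else 0) \<le> (\<Sum>t\<in>{r<..r + d}. b r)" .
  qed
  finally show ?thesis
    by (simp add: sum_distrib_left)
qed

text \<open>From \<open>t0\<close> on, \<open>F\<close> minus the partial sums of \<open>h\<close>
  does not increase; the finitely many earlier values are absorbed into the constant. A descent
  inequality that holds only eventually can thus be summed from 0.\<close>

lemma le_const_plus_sum:
  fixes F h :: "nat \<Rightarrow> real"
  assumes "\<And>t. t \<ge> t0 \<Longrightarrow> F (Suc t) \<le> F t + h t"
  shows "\<exists>C. \<forall>M. F M \<le> C + (\<Sum>t<M. h t)"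
proof -
  define E where "E M = F M - (\<Sum>t<M. h t)" for M
  have dec: "E (t0 + m) \<le> E t0" for m
  proof (induction m)
    case (Suc m)
    then show ?case
      using assms[of "t0 + m"] by (simp add: E_def)
  qed simp
  have "E M \<le> Max (E ` {..t0})" for M
  proof (cases "M \<le> t0")
    case True
    then show ?thesis by simp
  next
    case False
    then have "E M \<le> E t0"
      using dec[of "M - t0"] by simp
    also have "\<dots> \<le> Max (E ` {..t0})"
      by simp
    finally show ?thesis .
  qed
  then show ?thesis
    unfolding E_def by (metis diff_le_eq)
qed

text \<open>Young's inequality turns every product of step lengths into squares; the squares produced by
  delayed steps are charged to the time at which the step was taken.\<close>

lemma delayed_descent:
  fixes a :: "'a::finite \<Rightarrow> nat \<Rightarrow> real" and F :: "nat \<Rightarrow> real" and D :: "'a \<Rightarrow> 'a \<Rightarrow> nat"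
  assumes L_nonneg: "\<And>i j. 0 \<le> L i j" and L_sym: "\<And>i j. L i j = L j i"
    and a_nonneg: "\<And>i t. 0 \<le> a i t"
    and \<beta>: "\<And>i. (\<Sum>j\<in>UNIV. L i j * (1 + real (D i j) + real (D j i))) / 2 < \<beta> i"
    and desc: "\<And>t. t \<ge> t0 \<Longrightarrow> F (Suc t) \<le> F t - (\<Sum>i\<in>UNIV. \<beta> i * (a i t)\<^sup>2)
          + (\<Sum>i\<in>UNIV. \<Sum>j\<in>UNIV. L i j * a i t * a j t) / 2
          + (\<Sum>i\<in>UNIV. \<Sum>j\<in>UNIV. L i j * a i t * (\<Sum>r\<in>{t - D i j..<t}. a j r))"
    and lower: "\<And>t. t \<ge> t0 \<Longrightarrow> B \<le> F t"
  shows "a i \<longlonglongrightarrow> 0" and "\<exists>C. \<forall>t. F t \<le> C"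
proof -
  \<comment> \<open>The margin that remains in the coefficient of the squared steps of
    \<open>i\<close> once all products and delays are paid for; \<beta> makes it positive.\<close>
  define c where "c i = \<beta> i - (\<Sum>j\<in>UNIV. L i j * (1 + real (D i j) + real (D j i))) / 2" for i
  define h where "h t = - (\<Sum>i\<in>UNIV. \<beta> i * (a i t)\<^sup>2)
      + (\<Sum>i\<in>UNIV. \<Sum>j\<in>UNIV. L i j * (a i t)\<^sup>2) / 2
      + (\<Sum>i\<in>UNIV. \<Sum>j\<in>UNIV. L i j * (real (D i j) * (a i t)\<^sup>2 + (\<Sum>r\<in>{t - D i j..<t}. (a j r)\<^sup>2))) / 2" for t
  define S where "S M i = (\<Sum>t<M. (a i t)\<^sup>2)" for M i
  have young: "u * v \<le> (u\<^sup>2 + v\<^sup>2) / 2" for u v :: real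
    using sum_squares_bound[of u v] by simp
  \<comment> \<open>Interchanging the names of the agents and using the symmetry of \<open>L\<close>
    moves squares belonging to \<open>j\<close> over to \<open>i\<close>.\<close>
  have swap: "(\<Sum>i\<in>UNIV. \<Sum>j\<in>UNIV. L i j * W i j * w j) = (\<Sum>i\<in>UNIV. \<Sum>j\<in>UNIV. L i j * W j i * w i)"
    for w :: "'a \<Rightarrow> real" and W
    by (subst sum.swap, intro sum.cong refl, subst L_sym, rule refl)
  have step: "F (Suc t) \<le> F t + h t" if "t \<ge> t0" for t
  proof -
    have "(\<Sum>i\<in>UNIV. \<Sum>j\<in>UNIV. L i j * a i t * a j t)
        \<le> (\<Sum>i\<in>UNIV. \<Sum>j\<in>UNIV. L i j * (((a i t)\<^sup>2 + (a j t)\<^sup>2) / 2))"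
      using young L_nonneg by (intro sum_mono) (simp only: mult.assoc mult_left_mono)
    also have "\<dots> = (\<Sum>i\<in>UNIV. \<Sum>j\<in>UNIV. L i j * (a i t)\<^sup>2)"
      using swap[of "\<lambda>_ _. 1" "\<lambda>i. (a i t)\<^sup>2"]
      by (simp add: add_divide_distrib distrib_left sum.distrib sum_divide_distrib[symmetric])
    finally have 1: "(\<Sum>i\<in>UNIV. \<Sum>j\<in>UNIV. L i j * a i t * a j t) \<le> \<dots>" .
    have "a i t * (\<Sum>r\<in>{t - D i j..<t}. a j r)
        \<le> (real (D i j) * (a i t)\<^sup>2 + (\<Sum>r\<in>{t - D i j..<t}. (a j r)\<^sup>2)) / 2" for i j
    proof -
      have "a i t * (\<Sum>r\<in>{t - D i j..<t}. a j r) \<le> (\<Sum>r\<in>{t - D i j..<t}. ((a i t)\<^sup>2 + (a j r)\<^sup>2) / 2)"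
        unfolding sum_distrib_left by (intro sum_mono young)
      \<comment> \<open>The factor \<open>t - (t - D i j)\<close> is the number of times in the
        window, which is shorter than \<open>D i j\<close> when truncated at 0.\<close>
      also have "\<dots> = (real (t - (t - D i j)) * (a i t)\<^sup>2 + (\<Sum>r\<in>{t - D i j..<t}. (a j r)\<^sup>2)) / 2"
        by (simp add: sum_divide_distrib[symmetric] sum.distrib)
      also have "\<dots> \<le> (real (D i j) * (a i t)\<^sup>2 + (\<Sum>r\<in>{t - D i j..<t}. (a j r)\<^sup>2)) / 2"
        by (intro divide_right_mono add_right_mono mult_right_mono) auto
      finally show ?thesis .
    qed
    then have "(\<Sum>i\<in>UNIV. \<Sum>j\<in>UNIV. L i j * a i t * (\<Sum>r\<in>{t - D i j..<t}. a j r))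
        \<le> (\<Sum>i\<in>UNIV. \<Sum>j\<in>UNIV. L i j * ((real (D i j) * (a i t)\<^sup>2 + (\<Sum>r\<in>{t - D i j..<t}. (a j r)\<^sup>2)) / 2))"
      using L_nonneg by (intro sum_mono) (simp only: mult.assoc mult_left_mono)
    also have "\<dots> = (\<Sum>i\<in>UNIV. \<Sum>j\<in>UNIV. L i j * (real (D i j) * (a i t)\<^sup>2 + (\<Sum>r\<in>{t - D i j..<t}. (a j r)\<^sup>2))) / 2"
      by (simp add: sum_divide_distrib)
    finally show ?thesis
      using desc[OF that] 1 unfolding h_def by linarith
  qed
  have sum_h: "(\<Sum>t<M. h t) \<le> - (\<Sum>i\<in>UNIV. c i * S M i)" for M
  proof -
    have "(\<Sum>t<M. h t) = - (\<Sum>i\<in>UNIV. \<beta> i * S M i) + (\<Sum>i\<in>UNIV. \<Sum>j\<in>UNIV. L i j * S M i) / 2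
        + (\<Sum>i\<in>UNIV. \<Sum>j\<in>UNIV. L i j * (real (D i j) * S M i + (\<Sum>t<M. \<Sum>r\<in>{t - D i j..<t}. (a j r)\<^sup>2))) / 2"
      unfolding h_def S_def sum.distrib sum_negf sum_divide_distrib[symmetric]
        sum.swap[of _ _ "{..<M}"] sum_distrib_left[symmetric] by simp
    \<comment> \<open>Each squared step of \<open>j\<close> falls into at most \<open>D i j\<close>
      windows of \<open>i\<close>. Once \<open>swap\<close> is applied, this cost becomes the
      summand \<open>D j i\<close> in \<open>c i\<close>.\<close>
    also have "\<dots> \<le> - (\<Sum>i\<in>UNIV. \<beta> i * S M i) + (\<Sum>i\<in>UNIV. \<Sum>j\<in>UNIV. L i j * S M i) / 2
        + (\<Sum>i\<in>UNIV. \<Sum>j\<in>UNIV. L i j * (real (D i j) * S M i + real (D i j) * S M j)) / 2"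
      unfolding S_def
      by (intro add_left_mono divide_right_mono sum_mono mult_left_mono delayed_sum_le L_nonneg) auto
    also have "\<dots> = - (\<Sum>i\<in>UNIV. c i * S M i)"
      using swap[of "\<lambda>i j. real (D i j)" "S M"]
      by (simp add: c_def sum.distrib sum_negf sum_subtractf distrib_left distrib_right left_diff_distrib
          sum_distrib_right sum_divide_distrib[symmetric] add_divide_distrib mult.assoc)
    finally show ?thesis .
  qed
  obtain C where C: "F M \<le> C + (\<Sum>t<M. h t)" for M
    using le_const_plus_sum[of t0 F h] step by blast
  have c_pos: "c i > 0" for i
    using \<beta>[of i] by (simp add: c_def)
  have S_nonneg: "0 \<le> c i * S M i" for M i
    using c_pos[of i] by (simp add: S_def sum_nonneg)
  have upper: "F M + c i * S M i \<le> C" for M i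
  proof -
    have "c i * S M i \<le> (\<Sum>i\<in>UNIV. c i * S M i)"
      using S_nonneg by (intro member_le_sum) auto
    then show ?thesis
      using C[of M] sum_h[of M] by linarith
  qed
  then show "\<exists>C. \<forall>t. F t \<le> C"
    using S_nonneg by (metis add_increasing2 order_trans order_refl)
  \<comment> \<open>The lower bound \<open>B\<close> holds only from \<open>t0\<close> on, so the
    partial sum is first extended to length \<open>M + t0\<close>.\<close>
  have "(\<Sum>t<M. (a i t)\<^sup>2) \<le> (C - B) / c i" for M
  proof -
    have "S M i \<le> S (M + t0) i"
      unfolding S_def by (intro sum_mono2) auto
    moreover have "c i * S (M + t0) i \<le> C - B"
      using upper[of "M + t0" i] lower[of "M + t0"] by simp
    ultimately have "S M i * c i \<le> C - B"
      using c_pos[of i] by (metis mult.commute mult_left_mono less_imp_le order_trans)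
    then show ?thesis
      using c_pos[of i] by (simp add: pos_le_divide_eq S_def)
  qed
  then have "summable (\<lambda>t. (a i t)\<^sup>2)"
    by (intro summableI_nonneg_bounded[where x = "(C - B) / c i"]) auto
  then have "(\<lambda>t. (a i t)\<^sup>2) \<longlonglongrightarrow> 0"
    by (rule summable_LIMSEQ_zero)
  then show "a i \<longlonglongrightarrow> 0"
    using tendsto_real_sqrt[of "\<lambda>t. (a i t)\<^sup>2" 0] a_nonneg by simp
qed

section \<open>Residual estimates and convergence to a separated set\<close>

text \<open>The hypothesis says that \<open>y\<close> satisfies the variational inequality for the
  gradient at \<open>x\<close> up to the error \<open>e\<close>. Testing it at the projection
  \<open>p\<close>, and the inequality characterizing \<open>p\<close> at \<open>y\<close>, bounds
  \<open>norm (y - p)\<close> by \<open>norm (y - x) + e\<close>; the triangle inequality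
  contributes \<open>norm (y - x)\<close> once more.\<close>

lemma norm_residual_vec_le:
  fixes X :: "(real ^ 'n::finite) set"
  assumes "convex X" "closed X" "y \<in> X" "0 \<le> e"
    and e: "\<And>z. z \<in> X \<Longrightarrow> grad f x \<bullet> (y - z) \<le> e * norm (y - z)"
  shows "norm (residual_vec X f x) \<le> 2 * norm (y - x) + e"
proof -
  define p where "p = closest_point X (x - grad f x)"
  have p: "p \<in> X"
    unfolding p_def using assms by (intro closest_point_in_set) auto
  have "(x - grad f x - p) \<bullet> (y - p) \<le> 0"
    unfolding p_def using assms by (intro closest_point_dot) auto
  then have "(norm (y - p))\<^sup>2 \<le> (y - x) \<bullet> (y - p) + grad f x \<bullet> (y - p)"
    by (simp add: power2_norm_eq_inner inner_diff_left)
  also have "\<dots> \<le> (norm (y - x) + e) * norm (y - p)"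
    using e[OF p] norm_cauchy_schwarz[of "y - x" "y - p"] by (simp add: distrib_right)
  finally have "norm (y - p) * norm (y - p) \<le> (norm (y - x) + e) * norm (y - p)"
    by (simp add: power2_eq_square)
  then have "norm (y - p) \<le> norm (y - x) + e"
    using \<open>0 \<le> e\<close> by (cases "y = p") auto
  moreover have "norm (x - p) \<le> norm (y - x) + norm (y - p)"
    using norm_triangle_ineq4[of "y - p" "y - x"] by simp
  ultimately show ?thesis
    by (simp add: residual_vec_def p_def)
qed

text \<open>Once the steps and the distances to \<open>p t\<close> are below a third of \<epsilon>,
  consecutive points \<open>p t\<close> and \<open>p (Suc t)\<close> are closer than \<epsilon> and
  therefore equal, so \<open>p\<close> is eventually constant.\<close>

lemma convergent_to_separated_set:
  fixes g :: "nat \<Rightarrow> 'v::real_normed_vector"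
  assumes "\<epsilon> > 0" and sep: "\<And>y z. y \<in> S \<Longrightarrow> z \<in> S \<Longrightarrow> y \<noteq> z \<Longrightarrow> \<epsilon> \<le> norm (y - z)"
    and steps: "(\<lambda>t. norm (g (Suc t) - g t)) \<longlonglongrightarrow> 0"
    and near: "\<forall>\<^sub>F t in sequentially. p t \<in> S" "(\<lambda>t. norm (g t - p t)) \<longlonglongrightarrow> 0"
  shows "\<exists>q\<in>S. (\<lambda>t. norm (g t - q)) \<longlonglongrightarrow> 0"
proof -
  have "\<forall>\<^sub>F t in sequentially. p t \<in> S \<and> norm (g (Suc t) - g t) < \<epsilon> / 3 \<and> norm (g t - p t) < \<epsilon> / 3"
    using near order_tendstoD(2)[OF steps, of "\<epsilon> / 3"] order_tendstoD(2)[OF near(2), of "\<epsilon> / 3"] \<open>\<epsilon> > 0\<close>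
    by (auto simp: eventually_conj_iff)
  then obtain t1 where t1: "\<And>t. t \<ge> t1 \<Longrightarrow> p t \<in> S \<and> norm (g (Suc t) - g t) < \<epsilon> / 3 \<and> norm (g t - p t) < \<epsilon> / 3"
    by (auto simp: eventually_sequentially)
  have const: "p (Suc t) = p t" if "t \<ge> t1" for t
  proof (rule ccontr)
    assume "p (Suc t) \<noteq> p t"
    then have "\<epsilon> \<le> norm (p (Suc t) - p t)"
      using t1 that by (intro sep) auto
    also have "\<dots> = norm ((g (Suc t) - g t) - (g (Suc t) - p (Suc t)) + (g t - p t))"
      by (simp add: algebra_simps)
    also have "\<dots> \<le> norm (g (Suc t) - g t) + norm (g (Suc t) - p (Suc t)) + norm (g t - p t)"
      by (meson norm_triangle_ineq norm_triangle_ineq4 add_right_mono order_trans)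
    also have "\<dots> < \<epsilon>"
      using t1[OF that] t1[of "Suc t"] that by auto
    finally show False
      by simp
  qed
  have eq: "p t = p t1" if "t \<ge> t1" for t
    using that by (induction t rule: dec_induct) (auto simp: const)
  have "\<forall>\<^sub>F t in sequentially. norm (g t - p t) = norm (g t - p t1)"
    using eventually_ge_at_top[of t1] by eventually_elim (drule eq, erule ssubst, rule refl)
  with near(2) have "(\<lambda>t. norm (g t - p t1)) \<longlonglongrightarrow> 0"
    by (rule Lim_transform_eventually)
  then show ?thesis
    using t1[of t1] by blast
qed

lemma norm_diff_le_sum_steps:
  fixes g :: "nat \<Rightarrow> 'v::real_normed_vector"
  assumes "s \<le> t"
  shows "norm (g t - g s) \<le> (\<Sum>r\<in>{s..<t}. norm (g (Suc r) - g r))"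
  using norm_sum[of "\<lambda>r. g (Suc r) - g r" "{s..<t}"] assms by (simp add: sum_Suc_diff')

section \<open>Convergence of the asynchronous iteration\<close>

theorem theorem2:
  fixes blk :: "'n::finite \<Rightarrow> 'a::finite"
    and f :: "real ^ 'n \<Rightarrow> real"
    and X :: "(real ^ 'n) set"
    and Xs :: "'a \<Rightarrow> (real ^ 'n) set"
    and L :: "'a \<Rightarrow> 'a \<Rightarrow> real"
    and D :: "'a \<Rightarrow> 'a \<Rightarrow> nat"
    and G :: "'a \<Rightarrow> nat"
    and \<gamma> :: "'a \<Rightarrow> real"
    and T :: "'a \<Rightarrow> nat set"
    and R :: "'a \<Rightarrow> 'a \<Rightarrow> nat set"
    and \<tau> :: "'a \<Rightarrow> 'a \<Rightarrow> nat \<Rightarrow> nat"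
    and x :: "'a \<Rightarrow> nat \<Rightarrow> real ^ 'n"
  assumes f_diff: "\<And>y. f differentiable (at y)"
    and X_prod: "X = block_product blk Xs"
    and Xs_block: "\<And>i. Xs i \<subseteq> block_space blk i"
    and Xs_nonempty: "\<And>i. Xs i \<noteq> {}"
    and Xs_closed: "\<And>i. closed (Xs i)"
    and Xs_convex: "\<And>i. convex (Xs i)"
    and f_bdd: "bdd_below (f ` X)"
    and L_nonneg: "\<And>i j. L i j \<ge> 0"
    and L_sym: "\<And>i j. L i j = L j i"
    and L_lipschitz: "\<And>i j y z. y \<in> X \<Longrightarrow> z \<in> X \<Longrightarrow>
          (\<And>k. k \<noteq> j \<Longrightarrow> block blk k y = block blk k z) \<Longrightarrow>
          norm (block blk i (grad f y) - block blk i (grad f z))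
            \<le> L i j * norm (block blk j y - block blk j z)"
    and delay: "\<And>i j t. t \<in> T i \<Longrightarrow> \<tau> i j t \<le> t \<and> t - \<tau> i j t \<le> D i j"
    and D_diag: "\<And>i. D i i = 0"
    and D_zero: "\<And>i j. L i j = 0 \<Longrightarrow> D i j = 0 \<and> D j i = 0"
    and update_gap: "\<And>i t. T i \<inter> {t..t + G i} \<noteq> {}"
    and error_bound: "\<And>\<alpha>. \<alpha> > 0 \<Longrightarrow> \<exists>\<delta>>0. \<exists>\<kappa>>0. \<forall>y\<in>X.
          f y \<le> \<alpha> \<and> norm (residual_vec X f y) \<le> \<delta> \<longrightarrow>
          (\<exists>y'\<in>solution_set X f.
             (\<forall>z\<in>solution_set X f. norm (y - y') \<le> norm (y - z)) \<and>
             norm (y - y') \<le> \<kappa> * norm (residual_vec X f y))"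
    and separated: "\<exists>\<epsilon>>0. \<forall>y\<in>solution_set X f. \<forall>z\<in>solution_set X f.
          y \<noteq> z \<longrightarrow> norm (y - z) \<ge> \<epsilon>"
    and algorithm: "async_bcd blk Xs f \<gamma> T R \<tau> x"
    and step_pos: "\<And>i. \<gamma> i > 0"
    and step_bound: "\<And>i. (\<Sum>j\<in>UNIV. L i j * (1 + real (D i j) + real (D j i))) \<noteq> 0 \<Longrightarrow>
          \<gamma> i < 2 / (\<Sum>j\<in>UNIV. L i j * (1 + real (D i j) + real (D j i)))"
  shows "\<exists>xstar\<in>solution_set X f. (\<lambda>t. norm (global_state blk x t - xstar)) \<longlonglongrightarrow> 0"
proof -
  define g where "g = global_state blk x"
  define a where "a i t = norm (block blk i (g (Suc t) - g t))" for i t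
  \<comment> \<open>The successor accounts for an update at time \<open>s\<close> being visible only
    at \<open>Suc s\<close>: by time \<open>G'\<close> every block has been projected at least
    once.\<close>
  define G' where "G' = Suc (Max (range G))"
  define d where "d = Max (range (\<lambda>(i, j). D i j))"
  \<comment> \<open>A further \<open>d\<close> steps ensure that the delayed blocks in use also date
    from times not before \<open>G'\<close>.\<close>
  define t0 where "t0 = G' + d"
  have a_nonneg: "0 \<le> a i t" for i t
    by (simp add: a_def)
  have D_le: "D i j \<le> d" for i j
    unfolding d_def by (rule Max_ge) (auto intro: rev_image_eqI[of "(i, j)"])
  have G_less: "G i < G'" for i
    by (simp add: G'_def less_Suc_eq_le)
  have alg: "block blk i (x i (Suc t)) =
        (if t \<in> T i
         then closest_point (Xs i) (block blk i (x i t) - \<gamma> i *\<^sub>R block blk i (grad f (x i t)))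
         else block blk i (x i t))" for i t
    using algorithm unfolding async_bcd_def by auto
  have block_g: "block blk i (g t) = block blk i (x i t)" for i t
    by (simp add: g_def)
  have delayed: "block blk j (x i t) = block blk j (g (\<tau> i j t))" for i j t
    using algorithm unfolding async_bcd_def latest_index_def block_g by blast
  have g_Suc: "block blk i (g (Suc t)) =
        (if t \<in> T i
         then closest_point (Xs i) (block blk i (g t) - \<gamma> i *\<^sub>R block blk i (grad f (x i t)))
         else block blk i (g t))" for i t
    unfolding block_g by (rule alg)
  have convex_X: "convex X" and closed_X: "closed X"
    unfolding X_prod using Xs_convex Xs_closed by (auto intro: convex_block_product closed_block_product)
  have lip: "norm (block blk i (grad f y - grad f z)) \<le> (\<Sum>j\<in>UNIV. L i j * norm (block blk j (y - z)))"
    if "y \<in> X" "z \<in> X" for i y z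
    using lipschitz_of_block_lipschitz[where F = "\<lambda>y. block blk i (grad f y)" and L = "L i"]
      L_lipschitz that unfolding X_prod block_diff by blast

  \<comment> \<open>Eventual feasibility\<close>
  have Xs_Suc: "block blk i (g (Suc t)) \<in> Xs i" if "t \<in> T i \<or> block blk i (g t) \<in> Xs i" for i t
    using that g_Suc[of i t] closest_point_in_set[OF Xs_closed Xs_nonempty] by auto
  \<comment> \<open>The initial copies may be infeasible; a block enters its set at its first
    projection and stays there.\<close>
  have Xs_late: "block blk i (g t) \<in> Xs i" if t: "t \<ge> G'" for i t
  proof -
    obtain s where s: "s \<in> T i" "s \<le> G i"
      using update_gap[of i 0] by auto
    with t G_less[of i] have "Suc s \<le> t"
      by simp
    then show ?thesis
      by (induction t rule: dec_induct) (use Xs_Suc s in auto)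
  qed
  have g_X: "g t \<in> X" if "t \<ge> G'" for t
    using Xs_late that by (simp add: X_prod mem_block_product)
  have \<tau>_bounds: "\<tau> i j t \<le> t" "t - D i j \<le> \<tau> i j t" if "t \<in> T i" for i j t
    using delay[OF that, of j] by auto
  have x_X: "x i t \<in> X" if "t \<in> T i" "t \<ge> t0" for i t
    using Xs_late \<tau>_bounds[OF \<open>t \<in> T i\<close>] D_le \<open>t \<ge> t0\<close> unfolding X_prod mem_block_product delayed t0_def
    by (meson add_le_imp_le_diff diff_le_mono2 order_trans)

  \<comment> \<open>Optimality of block projections and descent along the trajectory\<close>
  have optimality: "block blk i (grad f (x i t)) \<bullet> (block blk i (g (Suc t)) - z)
      \<le> block blk i (g (Suc t) - g t) \<bullet> (z - block blk i (g (Suc t))) / \<gamma> i"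
    if "t \<in> T i" "z \<in> Xs i" for i t z
  proof -
    have "(block blk i (g t) - \<gamma> i *\<^sub>R block blk i (grad f (x i t)) - block blk i (g (Suc t)))
        \<bullet> (z - block blk i (g (Suc t))) \<le> 0"
      using closest_point_dot[OF Xs_convex Xs_closed \<open>z \<in> Xs i\<close>] g_Suc[of i t] \<open>t \<in> T i\<close> by simp
    then have "block blk i (grad f (x i t)) \<bullet> (block blk i (g (Suc t)) - z) * \<gamma> i
        \<le> block blk i (g (Suc t) - g t) \<bullet> (z - block blk i (g (Suc t)))"
      by (simp add: block_diff inner_diff_left inner_diff_right algebra_simps)
    then show ?thesis
      using step_pos[of i] by (simp only: pos_le_divide_eq)
  qed
  have move: "norm (block blk j (g t - g s)) \<le> (\<Sum>r\<in>{s..<t}. a j r)" if "s \<le> t" for j s t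
    using norm_diff_le_sum_steps[OF that, of "\<lambda>t. block blk j (g t)"] by (simp add: a_def block_diff)

  \<comment> \<open>The gradient at \<open>g t\<close> is the gradient at the outdated copy
    \<open>x i t\<close> plus a difference. The first part gives the negative squares through the
    optimality of the projection; the second is the price of the delays and is bounded by the steps
    taken since \<open>\<tau> i j t\<close>.\<close>
  have descent: "f (g (Suc t)) \<le> f (g t) - (\<Sum>i\<in>UNIV. inverse (\<gamma> i) * (a i t)\<^sup>2)
        + (\<Sum>i\<in>UNIV. \<Sum>j\<in>UNIV. L i j * a i t * a j t) / 2
        + (\<Sum>i\<in>UNIV. \<Sum>j\<in>UNIV. L i j * a i t * (\<Sum>r\<in>{t - D i j..<t}. a j r))"
    if t: "t \<ge> t0" for t
  proof -
    have gX: "g t \<in> X" "g (Suc t) \<in> X"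
      using t by (auto intro!: g_X simp: t0_def)
    have "block blk i (grad f (g t)) \<bullet> block blk i (g (Suc t) - g t)
        \<le> (\<Sum>j\<in>UNIV. L i j * a i t * (\<Sum>r\<in>{t - D i j..<t}. a j r)) - inverse (\<gamma> i) * (a i t)\<^sup>2" for i
    proof (cases "t \<in> T i")
      case False
      then have "block blk i (g (Suc t) - g t) = 0"
        by (simp add: block_diff g_Suc)
      then show ?thesis
        by (simp add: a_def)
    next
      case True
      let ?s = "block blk i (g (Suc t) - g t)"
      \<comment> \<open>The projection inequality is tested at the old block, which is feasible
        because \<open>t\<close> is at least \<open>G'\<close>.\<close>
      have "block blk i (grad f (x i t)) \<bullet> ?s \<le> ?s \<bullet> (- ?s) / \<gamma> i"
        using optimality[OF True Xs_late[of t i]] t by (simp add: t0_def block_diff)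
      then have own: "block blk i (grad f (x i t)) \<bullet> ?s \<le> - (inverse (\<gamma> i) * (a i t)\<^sup>2)"
        by (simp add: a_def power2_norm_eq_inner divide_inverse mult.commute)
      have "block blk i (grad f (g t) - grad f (x i t)) \<bullet> ?s
          \<le> norm (block blk i (grad f (g t) - grad f (x i t))) * a i t"
        unfolding a_def by (rule norm_cauchy_schwarz)
      also have "\<dots> \<le> (\<Sum>j\<in>UNIV. L i j * norm (block blk j (g t - x i t))) * a i t"
        using lip[OF gX(1) x_X[OF True t]] a_nonneg by (intro mult_right_mono)
      also have "\<dots> \<le> (\<Sum>j\<in>UNIV. L i j * (\<Sum>r\<in>{t - D i j..<t}. a j r)) * a i t"
      proof (intro mult_right_mono sum_mono mult_left_mono L_nonneg a_nonneg)
        fix j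
        have "norm (block blk j (g t - x i t)) \<le> (\<Sum>r\<in>{\<tau> i j t..<t}. a j r)"
          using move[OF \<tau>_bounds(1)[OF True], of j j] by (simp add: block_diff delayed)
        also have "\<dots> \<le> (\<Sum>r\<in>{t - D i j..<t}. a j r)"
          using \<tau>_bounds(2)[OF True] a_nonneg by (intro sum_mono2) auto
        finally show "norm (block blk j (g t - x i t)) \<le> \<dots>" .
      qed
      finally show ?thesis
        using own by (simp add: block_diff inner_diff_left sum_distrib_left sum_distrib_right mult_ac)
    qed
    then have "grad f (g t) \<bullet> (g (Suc t) - g t)
        \<le> (\<Sum>i\<in>UNIV. (\<Sum>j\<in>UNIV. L i j * a i t * (\<Sum>r\<in>{t - D i j..<t}. a j r)) - inverse (\<gamma> i) * (a i t)\<^sup>2)"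
      by (subst inner_eq_sum_block[of _ _ blk], intro sum_mono)
    then show ?thesis
      using block_descent[OF f_diff convex_X gX lip] by (simp add: a_def sum_subtractf)
  qed
  \<comment> \<open>The stepsize bound in reciprocal form. A vanishing sum is the case of an
    infinite bound, where positivity of \<open>\<gamma> i\<close> suffices.\<close>
  have coercive: "(\<Sum>j\<in>UNIV. L i j * (1 + real (D i j) + real (D j i))) / 2 < inverse (\<gamma> i)" for i
  proof (cases "(\<Sum>j\<in>UNIV. L i j * (1 + real (D i j) + real (D j i))) = 0")
    case True
    then show ?thesis
      using step_pos[of i] by simp
  next
    case False
    let ?A = "\<Sum>j\<in>UNIV. L i j * (1 + real (D i j) + real (D j i))"
    have "0 \<le> ?A"
      by (intro sum_nonneg mult_nonneg_nonneg L_nonneg) simp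
    with False have "0 < ?A"
      by simp
    then have "\<gamma> i * ?A < 2"
      using step_bound[OF False] by (simp only: pos_less_divide_eq)
    then show ?thesis
      using step_pos[of i] by (simp only: inverse_eq_divide pos_less_divide_eq) (simp add: mult.commute)
  qed
  obtain B where B: "B \<le> f (g t)" if "t \<ge> t0" for t
    using f_bdd g_X unfolding bdd_below_def t0_def by fastforce
  have a_lim: "a i \<longlonglongrightarrow> 0" for i
    using delayed_descent(1)[where F = "\<lambda>t. f (g t)" and a = a, OF L_nonneg L_sym a_nonneg coercive descent B] .
  obtain C where C: "f (g t) \<le> C" for t
    using delayed_descent(2)[where F = "\<lambda>t. f (g t)" and a = a, OF L_nonneg L_sym a_nonneg coercive descent B] by blast

  \<comment> \<open>The residual is bounded by recent steps\<close>
  define w where "w t = (\<Sum>k<d + G'. \<Sum>j\<in>UNIV. a j (t + k))" for t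
  have w_lim: "w \<longlonglongrightarrow> 0"
    unfolding w_def by (intro tendsto_null_sum LIMSEQ_ignore_initial_segment a_lim)
  have w_nonneg: "0 \<le> w t" for t
    unfolding w_def by (intro sum_nonneg a_nonneg)
  \<comment> \<open>\<open>w t\<close> adds the step lengths of all agents over a window of length
    \<open>d + G'\<close>, so it dominates the movement of any block between two times in that
    window.\<close>
  have in_window: "norm (block blk j (g s - g r)) \<le> w t"
    if "t \<le> r" "r \<le> t + d + G'" "t \<le> s" "s \<le> t + d + G'" for j r s t
  proof -
    have *: "norm (block blk j (g s - g r)) \<le> w t" if "t \<le> r" "r \<le> s" "s \<le> t + d + G'" for r s
    proof -
      have "norm (block blk j (g s - g r)) \<le> (\<Sum>k\<in>{r..<s}. a j k)"
        by (rule move[OF \<open>r \<le> s\<close>])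
      also have "\<dots> \<le> (\<Sum>k\<in>{t..<t + (d + G')}. a j k)"
        using that a_nonneg by (intro sum_mono2) auto
      also have "\<dots> = (\<Sum>k<d + G'. a j (t + k))"
        using sum.shift_bounds_nat_ivl[of "a j" 0 t "d + G'"] by (simp add: atLeast0LessThan add.commute)
      also have "\<dots> \<le> w t"
        unfolding w_def using a_nonneg by (intro sum_mono member_le_sum) auto
      finally show ?thesis .
    qed
    show ?thesis
      using *[of r s] *[of s r] that by (cases "r \<le> s") (auto simp: block_diff norm_minus_commute)
  qed
  define K where "K = 2 * real CARD('a) + (\<Sum>i\<in>UNIV. (\<Sum>j\<in>UNIV. L i j) + inverse (\<gamma> i))"
  \<comment> \<open>The residual is taken at time \<open>t + d\<close>, so that updates made from
    then on read values dating from \<open>t\<close> or later and everything stays in one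
    window.\<close>
  have residual: "norm (residual_vec X f (g (t + d))) \<le> K * w t" if t: "t \<ge> t0" for t
  proof -
    have "\<exists>s. s \<in> T i \<and> t + d \<le> s \<and> s < t + d + G'" for i
      using update_gap[of i "t + d"] G_less[of i] by fastforce
    then obtain s where s: "\<And>i. s i \<in> T i" "\<And>i. t + d \<le> s i" "\<And>i. s i < t + d + G'"
      by metis
    \<comment> \<open>The agents update at different times \<open>s i\<close>. Gluing the blocks
      just projected gives a point at which each block satisfies its own approximate variational
      inequality.\<close>
    define y where "y = assemble blk (\<lambda>i. g (Suc (s i)))"
    have block_y: "block blk i y = block blk i (g (Suc (s i)))" for i
      by (simp add: y_def)
    have y_X: "y \<in> X"
      unfolding X_prod mem_block_product block_y
    proof (intro allI Xs_late)
      show "G' \<le> Suc (s i)" for i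
        using s(2)[of i] t by (simp add: t0_def)
    qed
    have gX: "g (t + d) \<in> X"
      using t by (intro g_X) (simp add: t0_def)
    have near: "norm (y - g (t + d)) \<le> real CARD('a) * w t"
    proof -
      have "norm (block blk i (y - g (t + d))) \<le> w t" for i
        using in_window[of t "t + d" "Suc (s i)" i] s[of i] by (simp add: block_diff block_y)
      then have "(\<Sum>i\<in>UNIV. norm (block blk i (y - g (t + d)))) \<le> (\<Sum>i\<in>(UNIV::'a set). w t)"
        by (intro sum_mono)
      then show ?thesis
        using norm_le_sum_block[of "y - g (t + d)" blk] by simp
    qed
    \<comment> \<open>The part with \<open>L\<close> pays for replacing the outdated gradients by
      the gradient at \<open>g (t + d)\<close>; the part with \<open>inverse (\<gamma> i)\<close>
      bounds the step term in the optimality condition.\<close>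
    define e where "e = (\<Sum>i\<in>UNIV. (\<Sum>j\<in>UNIV. L i j) + inverse (\<gamma> i)) * w t"
    have e_nonneg: "0 \<le> e"
      unfolding e_def using step_pos
      by (intro mult_nonneg_nonneg sum_nonneg add_nonneg_nonneg L_nonneg w_nonneg) (simp add: less_imp_le)
    have "grad f (g (t + d)) \<bullet> (y - z) \<le> e * norm (y - z)" if "z \<in> X" for z
    proof -
      have "block blk i (grad f (g (t + d))) \<bullet> block blk i (y - z)
          \<le> ((\<Sum>j\<in>UNIV. L i j) + inverse (\<gamma> i)) * w t * norm (y - z)" for i
      proof -
        let ?x = "x i (s i)" and ?u = "block blk i (y - z)"
        have u: "norm ?u \<le> norm (y - z)"
          by (rule norm_block_le)
        have "norm (block blk i (grad f (g (t + d)) - grad f ?x)) \<le> (\<Sum>j\<in>UNIV. L i j * norm (block blk j (g (t + d) - ?x)))"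
          using s[of i] t by (intro lip gX x_X) auto
        also have "\<dots> \<le> (\<Sum>j\<in>UNIV. L i j * w t)"
        proof (intro sum_mono mult_left_mono L_nonneg)
          fix j
          show "norm (block blk j (g (t + d) - ?x)) \<le> w t"
            using in_window[of t "\<tau> i j (s i)" "t + d" j] \<tau>_bounds[OF s(1), of i j] D_le[of i j] s[of i]
            by (simp add: block_diff delayed)
        qed
        finally have "norm (block blk i (grad f (g (t + d)) - grad f ?x)) * norm ?u \<le> ((\<Sum>j\<in>UNIV. L i j) * w t) * norm (y - z)"
          using u by (intro mult_mono) (auto simp: sum_distrib_right intro!: sum_nonneg mult_nonneg_nonneg L_nonneg w_nonneg)
        then have 1: "block blk i (grad f (g (t + d)) - grad f ?x) \<bullet> ?u \<le> ((\<Sum>j\<in>UNIV. L i j) * w t) * norm (y - z)"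
          using norm_cauchy_schwarz order_trans by blast
        have "block blk i (grad f ?x) \<bullet> ?u \<le> (block blk i (g (Suc (s i)) - g (s i)) \<bullet> (- ?u)) / \<gamma> i"
          using optimality[OF s(1), of "block blk i z" i] that
          by (simp add: X_prod mem_block_product block_diff block_y)
        also have "\<dots> \<le> (w t * norm (y - z)) / \<gamma> i"
        proof (rule divide_right_mono)
          have "block blk i (g (Suc (s i)) - g (s i)) \<bullet> (- ?u)
              \<le> norm (block blk i (g (Suc (s i)) - g (s i))) * norm (- ?u)"
            by (rule norm_cauchy_schwarz)
          also have "\<dots> \<le> w t * norm (y - z)"
            using u in_window[of t "s i" "Suc (s i)" i] s[of i] w_nonneg by (intro mult_mono) auto
          finally show "block blk i (g (Suc (s i)) - g (s i)) \<bullet> (- ?u) \<le> w t * norm (y - z)" .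
        qed (use step_pos[of i] in simp)
        finally show ?thesis
          using 1 by (simp add: block_diff inner_diff_left algebra_simps divide_inverse)
      qed
      then have "(\<Sum>i\<in>UNIV. block blk i (grad f (g (t + d))) \<bullet> block blk i (y - z))
          \<le> (\<Sum>i\<in>UNIV. ((\<Sum>j\<in>UNIV. L i j) + inverse (\<gamma> i)) * w t * norm (y - z))"
        by (intro sum_mono)
      then show ?thesis
        by (subst inner_eq_sum_block[of _ _ blk]) (simp add: e_def sum_distrib_right)
    qed
    then have "norm (residual_vec X f (g (t + d))) \<le> 2 * norm (y - g (t + d)) + e"
      by (intro norm_residual_vec_le convex_X closed_X y_X e_nonneg)
    with near show ?thesis
      by (simp add: K_def e_def algebra_simps)
  qed

  \<comment> \<open>Vanishing residual and convergence to a solution\<close>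
  have residual_lim: "(\<lambda>t. norm (residual_vec X f (g t))) \<longlonglongrightarrow> 0"
  proof (rule LIMSEQ_offset[where k = d], rule tendsto_sandwich[OF _ _ tendsto_const])
    show "\<forall>\<^sub>F t in sequentially. norm (residual_vec X f (g (t + d))) \<le> K * w t"
      using residual by (auto simp: eventually_sequentially)
    show "(\<lambda>t. K * w t) \<longlonglongrightarrow> 0"
      using w_lim by (rule tendsto_mult_right_zero)
  qed simp

  \<comment> \<open>The error bound requires a positive level, while the upper bound
    \<open>C\<close> of \<open>f\<close> along the trajectory need not be positive.\<close>
  obtain \<delta> \<kappa> where "\<delta> > 0" "\<kappa> > 0" and eb: "\<And>y. y \<in> X \<Longrightarrow> f y \<le> max C 1 \<Longrightarrow> norm (residual_vec X f y) \<le> \<delta> \<Longrightarrow>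
      \<exists>y'\<in>solution_set X f. norm (y - y') \<le> \<kappa> * norm (residual_vec X f y)"
    using error_bound[of "max C 1"] by fastforce
  \<comment> \<open>A nearby solution is chosen at each time with a small residual; at other times
    \<open>p\<close> is unconstrained, so only eventual statements about it are made below.\<close>
  obtain p where p: "p t \<in> solution_set X f \<and> norm (g t - p t) \<le> \<kappa> * norm (residual_vec X f (g t))"
    if "t \<ge> G'" "norm (residual_vec X f (g t)) \<le> \<delta>" for t
    using eb[OF g_X] C by (metis max.coboundedI1)
  have "\<forall>\<^sub>F t in sequentially. norm (residual_vec X f (g t)) < \<delta>"
    using order_tendstoD(2)[OF residual_lim \<open>\<delta> > 0\<close>] .
  then have p_near: "\<forall>\<^sub>F t in sequentially.
      p t \<in> solution_set X f \<and> norm (g t - p t) \<le> \<kappa> * norm (residual_vec X f (g t))"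
    using eventually_ge_at_top[of G'] by eventually_elim (use p in auto)
  have "(\<lambda>t. norm (g t - p t)) \<longlonglongrightarrow> 0"
    by (rule tendsto_sandwich[OF _ _ tendsto_const tendsto_mult_right_zero[OF residual_lim, of \<kappa>]])
      (use p_near in \<open>auto elim: eventually_mono\<close>)
  moreover have "(\<lambda>t. norm (g (Suc t) - g t)) \<longlonglongrightarrow> 0"
  proof (rule tendsto_sandwich[OF _ _ tendsto_const])
    show "\<forall>\<^sub>F t in sequentially. norm (g (Suc t) - g t) \<le> (\<Sum>i\<in>UNIV. a i t)"
      unfolding a_def by (simp add: norm_le_sum_block)
    show "(\<lambda>t. \<Sum>i\<in>UNIV. a i t) \<longlonglongrightarrow> 0"
      by (intro tendsto_null_sum a_lim)
  qed simp
  moreover obtain \<epsilon> where "\<epsilon> > 0" "\<And>y z. y \<in> solution_set X f \<Longrightarrow> z \<in> solution_set X f \<Longrightarrow> y \<noteq> z \<Longrightarrow> \<epsilon> \<le> norm (y - z)"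
    using separated by blast
  ultimately show ?thesis
    using convergent_to_separated_set[of \<epsilon> "solution_set X f" g p] p_near
    unfolding g_def by (simp add: eventually_conj_iff)
qed

end
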